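(* Let $\alpha>-1$ and $n\ge 0$. Let $x_0<x_1<\dots<x_n$ be the roots of the Laguerre polynomial $L_{n+1}^{(\alpha+1)}$. Let $\hat w_1,\tilde w_0,\dots,\tilde w_n$ be the weights of the Gauss-Laguerre-Radau quadrature rule $$\int_0^\infty x^\alpha e^{-x}f(x)\,dx\simeq \hat w_1f(0)+\sum_{j=0}^n\tilde w_jf(x_j).$$ Consider the $n+2$ interpolation points $\{0\}\cup\{x_j\}_{j=0}^n$; let $\tilde\lambda_j$ denote the barycentric weight belonging to $x_j$, and $\hat\lambda_1$ the one belonging to $0$. Then $$\tilde\lambda_j=C^{(\alpha+1)}(-1)^j\sqrt{\tilde w_j},\quad j=0,\dots,n,\qquad \hat\lambda_1=-C^{(\alpha+1)}\sqrt{(\alpha+1)\hat w_1},$$ where $$C^{(\alpha+1)}=\sigma\,\frac{1}{\sqrt{\Gamma(n+\alpha+3)\,(n+1)!}},$$ with $\sigma=+1$ for even $n$ and $\sigma=-1$ for odd $n$.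
   Context: The barycentric weight belonging to a point $z$ of a finite set $Z$ of interpolation points is $\prod_{y\in Z,\,y\ne z}(z-y)^{-1}$. The Gauss-Laguerre-Radau rule above is the quadrature rule with nodes $0,x_0,\dots,x_n$ that is exact for all polynomials of degree at most $2n+2$. *)

theory Defs
  imports "HOL-Analysis.Analysis" "HOL-Computational_Algebra.Polynomial"
begin

text \<open>The sum is the standard expansion in the normalisation
  \<open>L_n^(\<alpha>)(0) = (n + \<alpha>) gchoose n\<close>, which agrees with the Rodrigues formula
  \<open>L_n^(\<alpha>)(x) = x^(-\<alpha>) e^x / n! (d/dx)^n (e^(-x) x^(n + \<alpha>))\<close>.\<close>

definition laguerre :: "nat \<Rightarrow> real \<Rightarrow> real poly" where
  "laguerre n \<alpha> =
     (\<Sum>k\<le>n. monom ((- 1) ^ k * ((real n + \<alpha>) gchoose (n - k)) / fact k) k)"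

definition barycentric_weight :: "real set \<Rightarrow> real \<Rightarrow> real" where
  "barycentric_weight Z z = (\<Prod>y\<in>Z - {z}. inverse (z - y))"

text \<open>\<open>v\<close> is the weight of the node \<open>0\<close>, and \<open>w j\<close> that of the node \<open>x j\<close> for \<open>j \<le> n\<close>.\<close>

definition gauss_laguerre_radau ::
  "real \<Rightarrow> nat \<Rightarrow> (nat \<Rightarrow> real) \<Rightarrow> real \<Rightarrow> (nat \<Rightarrow> real) \<Rightarrow> bool" where
  "gauss_laguerre_radau \<alpha> n x v w \<longleftrightarrow>
     (\<forall>p :: real poly. degree p \<le> 2 * n + 2 \<longrightarrow>
        (LBINT t:{0..}. t powr \<alpha> * exp (- t) * poly p t)
          = v * poly p 0 + (\<Sum>j\<le>n. w j * poly p (x j)))"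

text \<open>The argument \<open>\<alpha>\<close> is the exponent of the quadrature weight function, so this is the
  constant written \<open>C^(\<alpha> + 1)\<close>.\<close>

definition radau_const :: "real \<Rightarrow> nat \<Rightarrow> real" where
  "radau_const \<alpha> n =
     (if even n then 1 else - 1) * (1 / sqrt (Gamma (real n + \<alpha> + 3) * fact (n + 1)))"

end

theory Submission
  imports Defs "HOL-Computational_Algebra.Formal_Power_Series"
begin

text \<open>Write \<open>\<beta> = \<alpha> + 1\<close>, \<open>L = L_(n+1)^(\<beta>)\<close>, \<open>M = L_n^(\<beta>)\<close>, and let \<open>l\<close> be the leading coefficient of \<open>L\<close>.
  The quadrature rule applied to \<open>t M(t) L(t) / (t - x_j)\<close> sees only the node \<open>x_j\<close>, where it
  gives \<open>w_j x_j M(x_j) L'(x_j)\<close>; by orthogonality the integral depends only on \<open>l\<close>. The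
  recurrence \<open>t L' = (n + 1) L - (n + 1 + \<beta>) M\<close> turns \<open>M(x_j)\<close> into a multiple of \<open>x_j L'(x_j)\<close>,
  so \<open>w_j\<close> is a constant times the square of the barycentric weight \<open>l / (x_j L'(x_j))\<close>.
  Applied to \<open>L\<close> itself, the rule sees only the node \<open>0\<close> and gives \<open>v = \<Gamma>(\<beta>) / L(0)\<close>, while
  the barycentric weight of \<open>0\<close> is \<open>l / L(0)\<close>. The signs come from the ordering
  \<open>0 < x_0 < \<dots> < x_n\<close>.\<close>

section \<open>Integrals of polynomials against the quadrature weight\<close>

lemma has_bochner_integral_Gamma_monomial:
  fixes \<alpha> :: real
  assumes "\<alpha> > -1"
  shows "has_bochner_integral lborel (\<lambda>t. indicator {0..} t * (t powr \<alpha> * exp (- t) * t ^ k))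
           (Gamma (\<alpha> + 1 + real k))"
proof -
  have *: "indicator {0..} t * (t powr \<alpha> * exp (- t) * t ^ k)
           = indicator {0..} t * t powr (\<alpha> + 1 + real k - 1) / exp t" for t :: real
    by (cases "t > 0") (auto simp: indicator_def powr_add powr_realpow exp_minus field_simps)
  have "has_bochner_integral lborel
          (\<lambda>t. indicator {0..} t * t powr (\<alpha> + 1 + real k - 1) / exp t) (Gamma (\<alpha> + 1 + real k))"
  proof (rule has_bochner_integral_nn_integral)
    show "(\<integral>\<^sup>+ t. ennreal (indicator {0..} t * t powr (\<alpha> + 1 + real k - 1) / exp t) \<partial>lborel)
            = ennreal (Gamma (\<alpha> + 1 + real k))"
      by (rule Gamma_conv_nn_integral_real [symmetric]) (use assms in linarith)
    show "0 \<le> Gamma (\<alpha> + 1 + real k)"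
      by (rule Gamma_real_nonneg) (use assms in linarith)
  qed auto
  then show ?thesis
    by (simp only: *)
qed

text \<open>This turns every integral below into a finite sum of Gamma values. The index type is
  free and \<open>e\<close> need not be injective, so a product of two polynomials can be summed
  over pairs of indices without collecting powers.\<close>

lemma laguerre_weight_integral_sum:
  fixes \<alpha> :: real and c :: "'a \<Rightarrow> real" and e :: "'a \<Rightarrow> nat"
  assumes "\<alpha> > -1" and "finite A" and "\<And>t. f t = (\<Sum>i\<in>A. c i * t ^ e i)"
  shows "(LBINT t:{0..}. t powr \<alpha> * exp (- t) * f t) = (\<Sum>i\<in>A. c i * Gamma (\<alpha> + 1 + real (e i)))"
proof -
  have "has_bochner_integral lborel
          (\<lambda>t. \<Sum>i\<in>A. c i * (indicator {0..} t * (t powr \<alpha> * exp (- t) * t ^ e i)))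
          (\<Sum>i\<in>A. c i * Gamma (\<alpha> + 1 + real (e i)))"
    by (intro has_bochner_integral_sum has_bochner_integral_mult_right
        has_bochner_integral_Gamma_monomial assms(1))
  moreover have "(\<Sum>i\<in>A. c i * (indicator {0..} t * (t powr \<alpha> * exp (- t) * t ^ e i)))
      = indicator {0..} t *\<^sub>R (t powr \<alpha> * exp (- t) * f t)" for t
    by (simp add: assms(3) sum_distrib_left mult_ac)
  ultimately show ?thesis
    by (simp add: set_lebesgue_integral_def has_bochner_integral_integral_eq)
qed

section \<open>Laguerre polynomials: coefficients, roots, orthogonality and recurrence\<close>

lemma coeff_laguerre:
  "coeff (laguerre n \<beta>) k =
     (if k \<le> n then (- 1) ^ k * ((real n + \<beta>) gchoose (n - k)) / fact k else 0)"
  by (simp add: laguerre_def coeff_sum coeff_monom)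

lemma degree_laguerre: "degree (laguerre n \<beta>) = n"
  by (rule antisym [OF degree_le le_degree]) (auto simp: coeff_laguerre)

lemma lead_coeff_laguerre: "lead_coeff (laguerre n \<beta>) = (- 1) ^ n / fact n"
  by (simp add: degree_laguerre coeff_laguerre)

lemma poly_laguerre_eq_sum:
  "poly (laguerre n \<beta>) t = (\<Sum>k\<le>n. coeff (laguerre n \<beta>) k * t ^ k)"
  by (simp add: poly_altdef degree_laguerre)

lemma poly_laguerre_0: "poly (laguerre n \<beta>) 0 = (real n + \<beta>) gchoose n"
  by (simp add: poly_0_coeff_0 coeff_laguerre)

text \<open>For \<open>t \<le> 0\<close> the alternating signs of the coefficients cancel against
  those of the powers of \<open>t\<close>, so no term is negative, while the constant term is
  positive.\<close>

lemma laguerre_root_pos: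
  assumes "\<beta> > -1" and "poly (laguerre n \<beta>) t = 0"
  shows "t > 0"
proof (rule ccontr)
  assume "\<not> t > 0"
  \<comment> \<open>As a Pochhammer quotient, this coefficient has the positive base
    \<open>\<beta> + k + 1\<close>.\<close>
  have g: "(real n + \<beta>) gchoose (n - k) > 0" if "k \<le> n" for k
    unfolding gbinomial_pochhammer' using that assms(1)
    by (intro divide_pos_pos pochhammer_pos) (auto simp: of_nat_diff)
  have e: "coeff (laguerre n \<beta>) k * t ^ k
      = ((real n + \<beta>) gchoose (n - k)) / fact k * (- t) ^ k" if "k \<le> n" for k
    using that by (simp add: coeff_laguerre power_minus [of t])
  have "0 < (\<Sum>k\<le>n. coeff (laguerre n \<beta>) k * t ^ k)"
  proof (rule sum_pos2 [where i = 0])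
    show "0 < coeff (laguerre n \<beta>) 0 * t ^ 0"
      using g [of 0] by (simp add: coeff_laguerre)
    show "0 \<le> coeff (laguerre n \<beta>) k * t ^ k" if "k \<in> {..n}" for k
      using that \<open>\<not> t > 0\<close> g [of k] e [of k]
      by (metis atMost_iff divide_nonneg_pos fact_gt_zero less_imp_le mult_nonneg_nonneg
          neg_0_le_iff_le not_less zero_le_power)
  qed auto
  then show False
    using assms(2) by (simp add: poly_laguerre_eq_sum)
qed

text \<open>Since \<open>(- 1)^k \<Gamma>(b + k) / k! = \<Gamma>(b) (- b gchoose k)\<close>, this is Vandermonde's convolution.\<close>

lemma sum_coeff_laguerre_Gamma:
  fixes b :: real
  assumes "b > 0"
  shows "(\<Sum>k\<le>n. coeff (laguerre n \<beta>) k * Gamma (b + real k))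
           = Gamma b * ((real n + \<beta> - b) gchoose n)"
proof -
  have b: "b \<notin> \<int>\<^sub>\<le>\<^sub>0" and "Gamma b \<noteq> 0"
    using assms Gamma_real_pos [OF assms] by (auto elim!: nonpos_Ints_cases simp del: Gamma_real_pos)
  have "coeff (laguerre n \<beta>) k * Gamma (b + real k)
      = Gamma b * ((- b gchoose k) * ((real n + \<beta>) gchoose (n - k)))" if "k \<le> n" for k
    using that pochhammer_Gamma [OF b, of k] \<open>Gamma b \<noteq> 0\<close>
    by (simp add: coeff_laguerre gbinomial_pochhammer [of "- b"] field_simps)
  then show ?thesis
    using gbinomial_Vandermonde [of "- b" "real n + \<beta>" n]
    by (simp add: atMost_atLeast0 flip: sum_distrib_left)
qed

text \<open>The Vandermonde sum leaves \<open>n - m - 1\<close> over \<open>n\<close>. For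
  \<open>m < n\<close> the upper entry is a natural number below \<open>n\<close>, giving 0; for
  \<open>m = n\<close> it is -1, giving the sign.\<close>

lemma laguerre_moment:
  assumes "\<beta> > -1" and "m \<le> n"
  shows "(\<Sum>k\<le>n. coeff (laguerre n \<beta>) k * Gamma (\<beta> + 1 + real m + real k))
           = (if m = n then (- 1) ^ n * Gamma (\<beta> + 1 + real n) else 0)"
proof -
  have "((real n + \<beta> - (\<beta> + 1 + real m)) gchoose n) = (if m = n then (- 1) ^ n else 0)"
  proof (cases "m = n")
    case True
    then show ?thesis
      using gbinomial_minus [of "1 :: real" n] by (simp flip: binomial_gbinomial)
  next
    case False
    then have "real n + \<beta> - (\<beta> + 1 + real m) = real (n - m - 1)"
      using assms(2) by simp
    moreover have "real (n - m - 1) gchoose n = 0"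
      using False assms(2) unfolding binomial_gbinomial [symmetric] by simp
    ultimately show ?thesis
      using False by simp
  qed
  then show ?thesis
    using sum_coeff_laguerre_Gamma [of "\<beta> + 1 + real m" n \<beta>] assms(1) by simp
qed

text \<open>The factor \<open>t\<close> raises the weight exponent to \<open>\<alpha> + 1\<close>,
  the one matching the polynomial. All moments below the \<open>n\<close>-th then vanish, so only
  the top coefficient of \<open>q\<close> survives.\<close>

lemma laguerre_orthogonality:
  fixes \<alpha> :: real
  assumes "\<alpha> > -1" and "degree q \<le> n"
  shows "(LBINT t:{0..}. t powr \<alpha> * exp (- t) * (t * poly (laguerre n (\<alpha> + 1)) t * poly q t))
           = (- 1) ^ n * Gamma (\<alpha> + 2 + real n) * coeff q n"
proof -
  let ?c = "coeff (laguerre n (\<alpha> + 1))"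
  have q: "poly q t = (\<Sum>m\<le>n. coeff q m * t ^ m)" for t
    unfolding poly_altdef using assms(2)
    by (intro sum.mono_neutral_left) (auto simp: coeff_eq_0)
  have "(LBINT t:{0..}. t powr \<alpha> * exp (- t) * (t * poly (laguerre n (\<alpha> + 1)) t * poly q t))
      = (\<Sum>(m, k)\<in>{..n} \<times> {..n}. (coeff q m * ?c k) * Gamma (\<alpha> + 1 + real (Suc (m + k))))"
    unfolding case_prod_unfold
  proof (rule laguerre_weight_integral_sum)
    fix t :: real
    have "t * poly (laguerre n (\<alpha> + 1)) t * poly q t
        = t * ((\<Sum>m\<le>n. coeff q m * t ^ m) * (\<Sum>k\<le>n. ?c k * t ^ k))"
      by (simp add: poly_laguerre_eq_sum q)
    also have "\<dots> = (\<Sum>i\<in>{..n} \<times> {..n}. (coeff q (fst i) * ?c (snd i)) * t ^ Suc (fst i + snd i))"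
      unfolding sum_product sum.cartesian_product
      by (simp add: sum_distrib_left case_prod_unfold power_add mult_ac)
    finally show "t * poly (laguerre n (\<alpha> + 1)) t * poly q t
        = (\<Sum>i\<in>{..n} \<times> {..n}. (coeff q (fst i) * ?c (snd i)) * t ^ Suc (fst i + snd i))" .
  qed (use assms(1) in simp_all)
  also have "\<dots> = (\<Sum>m\<le>n. coeff q m * (\<Sum>k\<le>n. ?c k * Gamma (\<alpha> + 1 + 1 + real m + real k)))"
    by (simp add: sum_distrib_left algebra_simps flip: sum.cartesian_product)
  also have "\<dots> = (\<Sum>m\<le>n. coeff q m * (if m = n then (- 1) ^ n * Gamma (\<alpha> + 1 + 1 + real n) else 0))"
    using assms(1) by (intro sum.cong refl arg_cong2 [where f = "(*)"] laguerre_moment) auto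
  also have "\<dots> = (- 1) ^ n * Gamma (\<alpha> + 2 + real n) * coeff q n"
    by (simp add: if_distrib sum.delta cong: if_cong) (simp add: add_ac)
  finally show ?thesis .
qed

text \<open>Without the extra factor \<open>t\<close> the Vandermonde sum leaves \<open>n\<close>
  over \<open>n\<close>, which is 1.\<close>

lemma laguerre_integral_lower_weight:
  fixes \<alpha> :: real
  assumes "\<alpha> > -1"
  shows "(LBINT t:{0..}. t powr \<alpha> * exp (- t) * poly (laguerre n (\<alpha> + 1)) t) = Gamma (\<alpha> + 1)"
proof -
  have "(LBINT t:{0..}. t powr \<alpha> * exp (- t) * poly (laguerre n (\<alpha> + 1)) t)
      = (\<Sum>k\<le>n. coeff (laguerre n (\<alpha> + 1)) k * Gamma (\<alpha> + 1 + real k))"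
    by (rule laguerre_weight_integral_sum) (use assms in \<open>simp_all add: poly_laguerre_eq_sum\<close>)
  then show ?thesis
    using sum_coeff_laguerre_Gamma [of "\<alpha> + 1" n "\<alpha> + 1"] assms by (simp flip: binomial_gbinomial)
qed

text \<open>Coefficientwise this is the absorption identity for binomial coefficients.\<close>

lemma pderiv_laguerre_Suc:
  "[:0, 1:] * pderiv (laguerre (Suc n) \<beta>)
     = smult (real (Suc n)) (laguerre (Suc n) \<beta>) - smult (real (Suc n) + \<beta>) (laguerre n \<beta>)"
proof (rule poly_eqI)
  fix k
  have lhs: "coeff ([:0, 1:] * pderiv (laguerre (Suc n) \<beta>)) k = real k * coeff (laguerre (Suc n) \<beta>) k"
    by (cases k) (simp_all add: coeff_pderiv)
  have "(real (Suc n) - real k) * coeff (laguerre (Suc n) \<beta>) k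
      = (real (Suc n) + \<beta>) * coeff (laguerre n \<beta>) k"
  proof (cases "k \<le> n")
    case True
    then have "(real (Suc n) - real k) * ((real (Suc n) + \<beta>) gchoose (Suc n - k))
        = (real (Suc n) + \<beta>) * ((real n + \<beta>) gchoose (n - k))"
      using gbinomial_absorption [of "n - k" "real (Suc n) + \<beta>"]
      by (simp add: Suc_diff_le of_nat_diff algebra_simps)
    then show ?thesis
      using True by (simp add: coeff_laguerre field_simps)
  \<comment> \<open>For \<open>k = Suc n\<close> the factor on the left vanishes; beyond that both
    coefficients do.\<close>
  qed (auto simp: coeff_laguerre not_le le_Suc_eq)
  then show "coeff ([:0, 1:] * pderiv (laguerre (Suc n) \<beta>)) k
      = coeff (smult (real (Suc n)) (laguerre (Suc n) \<beta>) - smult (real (Suc n) + \<beta>) (laguerre n \<beta>)) k"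
    unfolding lhs by (simp add: algebra_simps)
qed

section \<open>Factorisation over the roots, and signs\<close>

lemma poly_eq_smult_prod_roots:
  fixes p :: "'a :: idom poly"
  assumes "finite A" and "degree p = card A" and "\<And>a. a \<in> A \<Longrightarrow> poly p a = 0"
  shows "p = smult (lead_coeff p) (\<Prod>a\<in>A. [:- a, 1:])"
proof (rule poly_eqI_degree_lead_coeff [of _ "card A" _ A])
  have deg: "degree (\<Prod>a\<in>A. [:- a, 1:]) = card A"
    by (subst degree_prod_eq_sum_degree) auto
  have "lead_coeff (\<Prod>a\<in>A. [:- a, 1:]) = 1"
    by (simp add: lead_coeff_prod)
  then show "coeff p (card A) = coeff (smult (lead_coeff p) (\<Prod>a\<in>A. [:- a, 1:])) (card A)"
    using assms(2) deg by simp
  show "degree (smult (lead_coeff p) (\<Prod>a\<in>A. [:- a, 1:])) \<le> card A"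
    using deg degree_smult_le by metis
  show "poly p z = poly (smult (lead_coeff p) (\<Prod>a\<in>A. [:- a, 1:])) z" if "z \<in> A" for z
    using that assms by (auto simp: poly_prod)
qed (use assms in auto)

text \<open>The negative factors are those with \<open>i > j\<close>, and there are
  \<open>n - j\<close> of them.\<close>

lemma sign_prod_differences:
  fixes x :: "nat \<Rightarrow> 'a :: linordered_idom"
  assumes "strict_mono_on {..n} x" and "j \<le> n"
  shows "0 < (- 1) ^ (n - j) * (\<Prod>i\<in>{..n} - {j}. x j - x i)"
proof -
  have split: "{..n} - {j} = {..<j} \<union> {j<..n}"
    using assms(2) by auto
  have "(\<Prod>i\<in>{..n} - {j}. x j - x i) = (\<Prod>i<j. x j - x i) * (\<Prod>i\<in>{j<..n}. x j - x i)"
    unfolding split by (rule prod.union_disjoint) auto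
  also have "(\<Prod>i\<in>{j<..n}. x j - x i) = (\<Prod>i\<in>{j<..n}. - 1 * (x i - x j))"
    by simp
  also have "\<dots> = (- 1) ^ (n - j) * (\<Prod>i\<in>{j<..n}. x i - x j)"
    unfolding prod.distrib by simp
  finally have "(- 1) ^ (n - j) * (\<Prod>i\<in>{..n} - {j}. x j - x i)
      = (\<Prod>i<j. x j - x i) * (\<Prod>i\<in>{j<..n}. x i - x j)"
    by (simp flip: power_add mult_2)
  moreover have "0 < (\<Prod>i<j. x j - x i)" "0 < (\<Prod>i\<in>{j<..n}. x i - x j)"
    using assms by (auto intro!: prod_pos simp: strict_mono_on_def)
  ultimately show ?thesis
    by simp
qed

text \<open>The quadrature identities determine only the square of a barycentric weight; the sign
  \<open>s\<close> selects the root.\<close>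

lemma eq_sign_times_sqrtI:
  fixes s y K W :: real
  assumes "s\<^sup>2 = 1" and "0 < s * y" and "0 < K" and "W = K * y\<^sup>2"
  shows "y = s / sqrt K * sqrt W"
proof -
  have "sqrt W = sqrt K * sqrt ((s * y)\<^sup>2)"
    using assms by (simp add: real_sqrt_mult power_mult_distrib)
  also have "sqrt ((s * y)\<^sup>2) = s * y"
    using assms(2) by simp
  finally show ?thesis
    using assms(1,3) by (simp add: power2_eq_square)
qed

theorem theorem13:
  fixes \<alpha> :: real and n :: nat and x w :: "nat \<Rightarrow> real" and v :: real
  assumes "\<alpha> > - 1"
    and "strict_mono_on {..n} x"
    and "{t. poly (laguerre (n + 1) (\<alpha> + 1)) t = 0} = x ` {..n}"
    and "gauss_laguerre_radau \<alpha> n x v w"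
  shows "(\<forall>j\<le>n. barycentric_weight (insert 0 (x ` {..n})) (x j)
                  = radau_const \<alpha> n * (- 1) ^ j * sqrt (w j))
       \<and> barycentric_weight (insert 0 (x ` {..n})) 0
           = - radau_const \<alpha> n * sqrt ((\<alpha> + 1) * v)"
proof -
  define \<beta> where "\<beta> = \<alpha> + 1"
  have "\<beta> > 0" using assms(1) by (simp add: \<beta>_def)
  define L where "L = laguerre (Suc n) \<beta>"
  define K where "K = Gamma (real n + \<alpha> + 3) * fact (n + 1)"
  have "K > 0" using assms(1) by (simp add: K_def Gamma_real_pos)
  have inj: "inj_on x {..n}"
    using assms(2) by (rule strict_mono_on_imp_inj_on)
  have root: "poly L (x i) = 0" if "i \<le> n" for i
    using assms(3) that by (auto simp: L_def \<beta>_def)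
  have xpos: "x i > 0" if "i \<le> n" for i
    using laguerre_root_pos [of \<beta> "Suc n" "x i"] root [OF that] \<open>\<beta> > 0\<close> by (simp add: L_def)
  have quad: "(LBINT t:{0..}. t powr \<alpha> * exp (- t) * poly p t)
      = v * poly p 0 + (\<Sum>i\<le>n. w i * poly p (x i))" if "degree p \<le> 2 * n + 2" for p
    using assms(4) that by (simp add: gauss_laguerre_radau_def)
  define l :: real where "l = (- 1) ^ Suc n / fact (Suc n)"
  have L_prod: "L = smult l (\<Prod>i\<le>n. [:- x i, 1:])"
  proof -
    have "L = smult (lead_coeff L) (\<Prod>a\<in>x ` {..n}. [:- a, 1:])"
      using root inj
      by (intro poly_eq_smult_prod_roots) (auto simp: L_def degree_laguerre card_image)
    then show ?thesis
      using inj by (simp add: prod.reindex L_def lead_coeff_laguerre l_def)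
  qed

  \<comment> \<open>The barycentric weights at the Laguerre roots\<close>
  have "barycentric_weight (insert 0 (x ` {..n})) (x j) = radau_const \<alpha> n * (- 1) ^ j * sqrt (w j)"
    if j: "j \<le> n" for j
  proof -
    \<comment> \<open>\<open>D\<close> omits the node 0, which contributes the separate factor
      \<open>x j\<close>. \<open>Q\<close> is \<open>L\<close> divided by \<open>t - x j\<close>, so
      \<open>l * D\<close> is both \<open>Q\<close> and the derivative of \<open>L\<close> at
      \<open>x j\<close>.\<close>
    define D where "D = (\<Prod>i\<in>{..n} - {j}. x j - x i)"
    define Q where "Q = smult l (\<Prod>i\<in>{..n} - {j}. [:- x i, 1:])"
    have sign: "0 < (- 1) ^ (n - j) * D"
      unfolding D_def using assms(2) j by (rule sign_prod_differences)
    then have "D \<noteq> 0" by auto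
    have bw: "barycentric_weight (insert 0 (x ` {..n})) (x j) = 1 / (x j * D)"
    proof -
      have "insert 0 (x ` {..n}) - {x j} = insert 0 (x ` ({..n} - {j}))"
        using xpos [OF j] inj j by (auto dest: inj_onD)
      moreover have "0 \<notin> x ` ({..n} - {j})"
        using xpos by force
      moreover have "inj_on x ({..n} - {j})"
        using inj by (rule inj_on_subset) auto
      ultimately show ?thesis
        by (simp add: barycentric_weight_def prod.reindex D_def divide_inverse prod_inversef [unfolded comp_def])
    qed
    have LQ: "L = [:- x j, 1:] * Q"
      using j by (simp add: L_prod Q_def prod.remove [of "{..n}" j])
    have degQ: "degree Q = n"
      using j by (simp add: Q_def l_def degree_prod_eq_sum_degree)
    have lcQ: "coeff Q n = l"
    proof -
      have "lead_coeff L = lead_coeff [:- x j, 1:] * lead_coeff Q"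
        by (simp only: LQ lead_coeff_mult)
      then show ?thesis
        by (simp add: degQ L_def l_def lead_coeff_laguerre)
    qed
    have Qj: "poly Q (x j) = l * D"
      by (simp add: Q_def D_def poly_prod)
    have Q0: "poly Q (x i) = 0" if "i \<le> n" "i \<noteq> j" for i
      using root [OF that(1)] that j inj by (auto simp: LQ dest: inj_onD)
    have rec: "x j * (l * D) = - (real (Suc n) + \<beta>) * poly (laguerre n \<beta>) (x j)"
    proof -
      have "poly (pderiv L) (x j) = l * D"
        unfolding LQ pderiv_mult by (simp add: pderiv_pCons Qj)
      moreover have "poly ([:0, 1:] * pderiv L) (x j)
          = - (real (Suc n) + \<beta>) * poly (laguerre n \<beta>) (x j)"
        using root [OF j] unfolding L_def pderiv_laguerre_Suc by (simp only: poly_diff poly_smult)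
      ultimately show ?thesis
        by simp
    qed
    \<comment> \<open>The test polynomial has degree at most \<open>2 * n + 1\<close>, within the
      exactness range. Its first factor removes the node 0, and \<open>Q\<close> removes every
      \<open>x i\<close> with \<open>i \<noteq> j\<close>.\<close>
    have "degree ([:0, 1:] * laguerre n \<beta> * Q) \<le> 2 * n + 2"
    proof -
      have "degree ([:0, 1:] * laguerre n \<beta> * Q) \<le> 1 + n + n"
        by (intro order.trans [OF degree_mult_le] add_mono) (simp_all add: degree_laguerre degQ)
      then show ?thesis by simp
    qed
    from quad [OF this]
    have "(- 1) ^ n * Gamma (\<beta> + 1 + real n) * l
        = (\<Sum>i\<le>n. w i * (x i * poly (laguerre n \<beta>) (x i) * poly Q (x i)))"
      using laguerre_orthogonality [of \<alpha> Q n] assms(1) degQ lcQ by (simp add: \<beta>_def ac_simps)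
    also have "\<dots> = (\<Sum>i\<in>{j}. w i * (x i * poly (laguerre n \<beta>) (x i) * poly Q (x i)))"
      using j Q0 by (intro sum.mono_neutral_right) auto
    finally have *: "(- 1) ^ n * Gamma (\<beta> + 1 + real n) * l
        = w j * (x j * poly (laguerre n \<beta>) (x j) * (l * D))"
      by (simp add: Qj)
    have l0: "l \<noteq> 0" and l2: "l * fact (Suc n) = - ((- 1) ^ n)"
      by (simp_all add: l_def)
    have G: "Gamma (real n + \<alpha> + 3) = (real (Suc n) + \<beta>) * Gamma (\<beta> + 1 + real n)"
      using Gamma_plus1 [of "\<beta> + 1 + real n"] \<open>\<beta> > 0\<close>
      by (simp add: \<beta>_def add_ac nonpos_Ints_def)
    have "w j * (x j * D)\<^sup>2 = K"
    proof -
      have nodal: "w j * (x j * poly (laguerre n \<beta>) (x j) * D)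
          = (- 1) ^ n * Gamma (\<beta> + 1 + real n)"
        using * l0 by (simp add: field_simps)
      \<comment> \<open>The extra factor \<open>l\<close> lets \<open>rec\<close> replace one of the
        two factors \<open>x j * D\<close> by a value of \<open>laguerre n \<beta>\<close>, which
        the quadrature identity then evaluates.\<close>
      have "l * (w j * (x j * D)\<^sup>2) = (w j * x j * D) * (x j * (l * D))"
        by (simp add: power2_eq_square)
      also have "\<dots> = - (real (Suc n) + \<beta>) * (w j * (x j * poly (laguerre n \<beta>) (x j) * D))"
        unfolding rec by (simp only: mult_ac)
      also have "\<dots> = - ((- 1) ^ n) * Gamma (real n + \<alpha> + 3)"
        unfolding nodal G by (simp add: algebra_simps)
      also have "\<dots> = l * fact (Suc n) * Gamma (real n + \<alpha> + 3)"
        by (rule arg_cong [OF l2 [symmetric]])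
      also have "\<dots> = l * K"
        unfolding K_def by (simp only: mult_ac Suc_eq_plus1)
      finally show ?thesis using l0 by simp
    qed
    then have W: "w j = K * (1 / (x j * D))\<^sup>2"
      using \<open>D \<noteq> 0\<close> xpos [OF j] by (simp add: field_simps)
    define s :: real where "s = (- 1) ^ (n - j)"
    have "1 / (x j * D) = s / sqrt K * sqrt (w j)"
    proof (rule eq_sign_times_sqrtI [OF _ _ \<open>K > 0\<close> W])
      show "s\<^sup>2 = 1" by (simp add: s_def flip: power_mult)
      have "s * (1 / (x j * D)) = (s * D) / (x j * D\<^sup>2)"
        using \<open>D \<noteq> 0\<close> by (simp add: power2_eq_square)
      then show "0 < s * (1 / (x j * D))"
        using sign xpos [OF j] \<open>D \<noteq> 0\<close> by (simp add: s_def)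
    qed
    \<comment> \<open>The parity of \<open>n\<close> in the constant combines with that of
      \<open>j\<close> to give the parity of \<open>n - j\<close>.\<close>
    moreover have "radau_const \<alpha> n * (- 1) ^ j = s / sqrt K"
      using j by (auto simp: radau_const_def K_def s_def minus_one_power_iff)
    ultimately show ?thesis
      by (simp add: bw)
  qed

  \<comment> \<open>The barycentric weight at 0\<close>
  moreover have "barycentric_weight (insert 0 (x ` {..n})) 0
      = - radau_const \<alpha> n * sqrt ((\<alpha> + 1) * v)"
  proof -
    define B where "B = poly L 0"
    have B: "B = Gamma (real n + \<alpha> + 3) / (fact (Suc n) * Gamma (\<beta> + 1))"
    proof -
      have "real (Suc n) + \<beta> + 1 \<notin> \<int>\<^sub>\<le>\<^sub>0"
        using \<open>\<beta> > 0\<close> by (auto elim!: nonpos_Ints_cases)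
      then show ?thesis
        using gbinomial_Gamma [of "real (Suc n) + \<beta>" "Suc n"]
        by (simp add: B_def L_def poly_laguerre_0 \<beta>_def add_ac)
    qed
    have "B > 0"
      unfolding B using assms(1) \<open>\<beta> > 0\<close> by (intro divide_pos_pos mult_pos_pos Gamma_real_pos) auto
    have bw: "barycentric_weight (insert 0 (x ` {..n})) 0 = l / B"
    proof -
      have "0 \<notin> x ` {..n}"
        using xpos by force
      then have "insert 0 (x ` {..n}) - {0} = x ` {..n}"
        by auto
      then have "barycentric_weight (insert 0 (x ` {..n})) 0 = inverse (\<Prod>i\<le>n. - x i)"
        using inj prod_inversef [of "\<lambda>i. - x i" "{..n}"]
        by (simp add: barycentric_weight_def prod.reindex comp_def)
      moreover have "B = l * (\<Prod>i\<le>n. - x i)"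
        by (simp add: B_def L_prod poly_prod)
      moreover have "l \<noteq> 0"
        by (simp add: l_def)
      ultimately show ?thesis
        by (simp add: divide_inverse)
    qed
    have vB: "v * B = Gamma \<beta>"
    proof -
      have "degree L \<le> 2 * n + 2"
        by (simp add: L_def degree_laguerre)
      moreover have "(LBINT t:{0..}. t powr \<alpha> * exp (- t) * poly L t) = Gamma \<beta>"
        unfolding L_def \<beta>_def by (rule laguerre_integral_lower_weight) (rule assms(1))
      ultimately show ?thesis
        using quad [of L] root by (simp add: B_def)
    qed
    \<comment> \<open>The factor \<open>\<alpha> + 1\<close> arises here: it turns
      \<open>Gamma \<beta>\<close> from \<open>vB\<close> into \<open>Gamma (\<beta> + 1)\<close>,
      which cancels the denominator of \<open>B\<close>.\<close>
    have W: "(\<alpha> + 1) * v = K * (l / B)\<^sup>2"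
    proof -
      have l2: "l\<^sup>2 = 1 / (fact (Suc n))\<^sup>2"
        by (simp add: l_def power_divide flip: power_mult)
      have "\<beta> \<notin> \<int>\<^sub>\<le>\<^sub>0"
        using \<open>\<beta> > 0\<close> by (auto elim!: nonpos_Ints_cases)
      then have "\<beta> * (v * B) = Gamma (\<beta> + 1)"
        using Gamma_plus1 [of \<beta>] vB by simp
      moreover have "Gamma (\<beta> + 1) * B = Gamma (real n + \<alpha> + 3) / fact (Suc n)"
      proof -
        have "Gamma (\<beta> + 1) \<noteq> 0"
          by (rule less_imp_neq [OF Gamma_real_pos, symmetric]) (use \<open>\<beta> > 0\<close> in simp)
        then show ?thesis
          by (simp add: B)
      qed
      moreover have "K * l\<^sup>2 = Gamma (real n + \<alpha> + 3) / fact (Suc n)"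
        unfolding K_def l2 by (simp add: power2_eq_square del: fact_Suc)
      ultimately have "(\<beta> * (v * B)) * B = K * l\<^sup>2"
        by simp
      then have "\<beta> * v * B\<^sup>2 = K * l\<^sup>2"
        by (simp only: power2_eq_square mult_ac)
      then show ?thesis
        using \<open>B > 0\<close> by (simp add: \<beta>_def field_simps)
    qed
    \<comment> \<open>Since \<open>B\<close> is positive, the sign is that of \<open>l\<close>; this
      is the opposite of the sign in \<open>radau_const\<close>, whence the minus in the
      claim.\<close>
    define s :: real where "s = (- 1) ^ Suc n"
    have "l / B = s / sqrt K * sqrt ((\<alpha> + 1) * v)"
      by (rule eq_sign_times_sqrtI [OF _ _ \<open>K > 0\<close> W])
        (use \<open>B > 0\<close> in \<open>auto simp: s_def l_def minus_one_power_iff\<close>)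
    moreover have "- radau_const \<alpha> n = s / sqrt K"
      by (auto simp: radau_const_def K_def s_def minus_one_power_iff)
    ultimately show ?thesis
      by (simp add: bw)
  qed
  ultimately show ?thesis
    by blast
qed

end
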